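(* Let $\omega$ be a non-quasianalytic weight function. Then $M(\mathcal{O}_{C,\omega}(\mathbb{R}^N))=\mathcal{O}_{C,\omega}(\mathbb{R}^N)$, where $M(\mathcal{O}_{C,\omega}(\mathbb{R}^N))$ is the space of multipliers of $\mathcal{O}_{C,\omega}(\mathbb{R}^N)$. Hence $(\mathcal{O}_{C,\omega}(\mathbb{R}^N),\cdot)$ is a multiplication algebra, i.e. it is closed under pointwise multiplication.
   Context: Weights. A non-quasianalytic weight function is a continuous increasing function $\omega:[0,\infty)\to[0,\infty)$ such that: ($\alpha$) there is $K\ge 1$ with $\omega(2t)\le K(1+\omega(t))$ for all $t\ge 0$; ($\beta$) $\int_1^\infty \frac{\omega(t)}{1+t^2}\,dt<\infty$; ($\gamma$) there are $a\in\mathbb{R}$, $b>0$ with $\omega(t)\ge a+b\log(1+t)$ for all $t\ge 0$; ($\delta$) $\varphi_\omega(t)=\omega(e^t)$ is convex. It is assumed (normalization) that $\omega$ vanishes on $[0,1]$. For $x\in\mathbb{R}^N$, $\omega(x):=\omega(|x|)$. The Young conjugate is $\varphi^*_\omega(s):=\sup_{t\ge 0}\{st-\varphi_\omega(t)\}$, $s\ge 0$ (the value $+\infty$ is allowed, with $\exp(-\infty)=0$). Spaces. $\mathcal{E}_\omega(\mathbb{R}^N)$ is the space of $\omega$-ultradifferentiable functions: all $f\in C^\infty(\mathbb{R}^N)$ with $p_{K,m}(f):=\sup_{x\in K}\sup_{\alpha\in\mathbb{N}_0^N}|\partial^\alpha f(x)|\exp\left(-m\varphi^*_\omega\left(\frac{|\alpha|}{m}\right)\right)<\infty$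 for all compact $K\subset\mathbb{R}^N$ and $m\in\mathbb{N}$, topologized by the seminorms $p_{K,m}$. For $m,n\in\mathbb{N}$ let $\mathcal{O}^m_{n,\omega}(\mathbb{R}^N)$ be the space of all $f\in C^\infty(\mathbb{R}^N)$ with $r_{m,n}(f):=\sup_{\alpha\in\mathbb{N}_0^N}\sup_{x\in\mathbb{R}^N}|\partial^\alpha f(x)|\exp\left(-n\omega(x)-m\varphi^*_\omega\left(\frac{|\alpha|}{m}\right)\right)<\infty$, with norm $r_{m,n}$. Set $\mathcal{O}_{C,\omega}(\mathbb{R}^N):=\bigcup_{n}\bigcap_{m}\mathcal{O}^m_{n,\omega}(\mathbb{R}^N)$ with the topology of the locally convex inductive limit over $n$ of the projective limits $\mathcal{O}_{n,\omega}(\mathbb{R}^N):=\mathrm{proj}_m\,\mathcal{O}^m_{n,\omega}(\mathbb{R}^N)$. It is continuously included in $\mathcal{E}_\omega(\mathbb{R}^N)$ with dense range. Multipliers. For a locally convex Hausdorff space $E$ of $\omega$-ultradifferentiable functions on $\mathbb{R}^N$ continuously included in $\mathcal{E}_\omega(\mathbb{R}^N)$ with dense range, $M(E)$ is the largest space of $\omega$-ultradifferentiable functions on $\mathbb{R}^N$ such that (1) $fg\in E$ for all $f\in E$, $g\in M(E)$, and (2) for all $f\in M(E)$ the operator $M_f:E\to E$, $g\mapsto fg$, is continuous. Thus $M(E)$ consists of all $f\in\mathcal{E}_\omega(\mathbb{R}^N)$ such that $fg\in E$ for all $g\in E$ and $g\mapsto fg$ is continuous on $E$. *)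

theory Defs
  imports "HOL-Analysis.Analysis"
begin

section \<open>Weight functions\<close>

text \<open>
  A weight is a function on the half line; its values at negative arguments are never used.
  The last condition is the normalization, and \<open>increasing\<close> is meant in the non-strict sense,
  as the normalization forces.
\<close>

definition nonquasianalytic_weight :: "(real \<Rightarrow> real) \<Rightarrow> bool" where
  "nonquasianalytic_weight \<omega> \<longleftrightarrow>
     continuous_on {0..} \<omega> \<and> mono_on {0..} \<omega> \<and> (\<forall>t\<ge>0. 0 \<le> \<omega> t) \<and>
     (\<exists>K\<ge>1. \<forall>t\<ge>0. \<omega> (2 * t) \<le> K * (1 + \<omega> t)) \<and>
     set_integrable lborel {1..} (\<lambda>t. \<omega> t / (1 + t\<^sup>2)) \<and>
     (\<exists>a. \<exists>b>0. \<forall>t\<ge>0. a + b * ln (1 + t) \<le> \<omega> t) \<and>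
     convex_on UNIV (\<lambda>t. \<omega> (exp t)) \<and>
     (\<forall>t\<in>{0..1}. \<omega> t = 0)"

definition young_conjugate :: "(real \<Rightarrow> real) \<Rightarrow> real \<Rightarrow> ereal" where
  "young_conjugate \<omega> s = (SUP t\<in>{0..}. ereal (s * t - \<omega> (exp t)))"

fun exp_ereal :: "ereal \<Rightarrow> ereal" where
  "exp_ereal (ereal r) = ereal (exp r)"
| "exp_ereal PInfty = \<infinity>"
| "exp_ereal MInfty = 0"


section \<open>Smooth functions and multi-index derivatives\<close>

definition partial :: "'n::finite \<Rightarrow> (real ^ 'n \<Rightarrow> complex) \<Rightarrow> real ^ 'n \<Rightarrow> complex" where
  "partial i f x = vector_derivative (\<lambda>t. f (x + t *\<^sub>R axis i 1)) (at 0)"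

text \<open>\<open>C\<^sup>\<infinity>\<close>: the partial derivatives of all orders, taken in any order, exist and are continuous.\<close>

definition smooth :: "(real ^ 'n::finite \<Rightarrow> complex) \<Rightarrow> bool" where
  "smooth f \<longleftrightarrow>
     (\<forall>js. continuous_on UNIV (foldr partial js f) \<and>
       (\<forall>i x. (\<lambda>t. foldr partial js f (x + t *\<^sub>R axis i 1)) differentiable (at 0)))"

text \<open>
  An arbitrary but fixed enumeration of the coordinates determines the order of differentiation
  in \<open>multi_partial\<close>; on smooth functions this order is immaterial.
\<close>

definition coordinates :: "'n::finite list" where
  "coordinates = (SOME js. distinct js \<and> set js = UNIV)"

definition multi_partial ::
    "('n::finite \<Rightarrow> nat) \<Rightarrow> (real ^ 'n \<Rightarrow> complex) \<Rightarrow> real ^ 'n \<Rightarrow> complex" where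
  "multi_partial \<alpha> f = foldr partial (concat (map (\<lambda>i. replicate (\<alpha> i) i) coordinates)) f"

definition multi_order :: "('n::finite \<Rightarrow> nat) \<Rightarrow> nat" where
  "multi_order \<alpha> = (\<Sum>i\<in>UNIV. \<alpha> i)"


section \<open>The spaces\<close>

text \<open>
  The (semi)norms are extended-real valued, so that finiteness can be stated for them.
  The parameters \<open>m\<close> and \<open>n\<close> range over the positive integers.
\<close>

definition E_seminorm ::
    "(real \<Rightarrow> real) \<Rightarrow> (real ^ 'n) set \<Rightarrow> nat \<Rightarrow> (real ^ 'n::finite \<Rightarrow> complex) \<Rightarrow> ereal" where
  "E_seminorm \<omega> K m f =
     (SUP x\<in>K. SUP \<alpha>. ereal (cmod (multi_partial \<alpha> f x)) *
        exp_ereal (- (ereal (real m) * young_conjugate \<omega> (real (multi_order \<alpha>) / real m))))"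

definition E_space :: "(real \<Rightarrow> real) \<Rightarrow> (real ^ 'n::finite \<Rightarrow> complex) set" where
  "E_space \<omega> = {f. smooth f \<and> (\<forall>K m. compact K \<longrightarrow> 1 \<le> m \<longrightarrow> E_seminorm \<omega> K m f < \<infinity>)}"

definition O_norm ::
    "(real \<Rightarrow> real) \<Rightarrow> nat \<Rightarrow> nat \<Rightarrow> (real ^ 'n::finite \<Rightarrow> complex) \<Rightarrow> ereal" where
  "O_norm \<omega> m n f =
     (SUP \<alpha>. SUP x. ereal (cmod (multi_partial \<alpha> f x)) *
        exp_ereal (- ereal (real n * \<omega> (norm x))
          - ereal (real m) * young_conjugate \<omega> (real (multi_order \<alpha>) / real m)))"

definition O_step ::
    "(real \<Rightarrow> real) \<Rightarrow> nat \<Rightarrow> nat \<Rightarrow> (real ^ 'n::finite \<Rightarrow> complex) set" where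
  "O_step \<omega> m n = {f. smooth f \<and> O_norm \<omega> m n f < \<infinity>}"

definition OC_space :: "(real \<Rightarrow> real) \<Rightarrow> (real ^ 'n::finite \<Rightarrow> complex) set" where
  "OC_space \<omega> = (\<Union>n\<in>{1..}. \<Inter>m\<in>{1..}. O_step \<omega> m n)"


section \<open>Topologies\<close>

text \<open>All vector spaces are complex vector spaces of functions with the pointwise operations.\<close>

definition norm_topology ::
    "('a \<Rightarrow> complex) set \<Rightarrow> (('a \<Rightarrow> complex) \<Rightarrow> ereal) \<Rightarrow> ('a \<Rightarrow> complex) topology" where
  "norm_topology X p = topology (\<lambda>U. U \<subseteq> X \<and>
     (\<forall>f\<in>U. \<exists>\<epsilon>>0. \<forall>g\<in>X. p (\<lambda>x. g x - f x) < ereal \<epsilon> \<longrightarrow> g \<in> U))"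

lemma openin_norm_topology:
  "openin (norm_topology X p) U \<longleftrightarrow>
     U \<subseteq> X \<and> (\<forall>f\<in>U. \<exists>\<epsilon>>0. \<forall>g\<in>X. p (\<lambda>x. g x - f x) < ereal \<epsilon> \<longrightarrow> g \<in> U)"
proof -
  let ?L = "\<lambda>U. U \<subseteq> X \<and>
     (\<forall>f\<in>U. \<exists>\<epsilon>>0. \<forall>g\<in>X. p (\<lambda>x. g x - f x) < ereal \<epsilon> \<longrightarrow> g \<in> U)"
  have "istopology ?L"
    unfolding istopology_def
  proof (intro conjI allI impI)
    fix S T assume S: "?L S" and T: "?L T"
    show "S \<inter> T \<subseteq> X" using S by blast
    show "\<forall>f\<in>S \<inter> T. \<exists>\<epsilon>>0. \<forall>g\<in>X. p (\<lambda>x. g x - f x) < ereal \<epsilon> \<longrightarrow> g \<in> S \<inter> T"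
    proof
      fix f assume f: "f \<in> S \<inter> T"
      from S f obtain d where d: "d > 0" "\<forall>g\<in>X. p (\<lambda>x. g x - f x) < ereal d \<longrightarrow> g \<in> S"
        by blast
      from T f obtain e where e: "e > 0" "\<forall>g\<in>X. p (\<lambda>x. g x - f x) < ereal e \<longrightarrow> g \<in> T"
        by blast
      have "p h < ereal d \<and> p h < ereal e" if "p h < ereal (min d e)" for h
        using that by (cases "d \<le> e") (auto simp: min_def intro: less_le_trans)
      then show "\<exists>\<epsilon>>0. \<forall>g\<in>X. p (\<lambda>x. g x - f x) < ereal \<epsilon> \<longrightarrow> g \<in> S \<inter> T"
        using d e by (intro exI[of _ "min d e"]) auto
    qed
  next
    fix \<K> assume K: "\<forall>S\<in>\<K>. ?L S"
    show "\<Union>\<K> \<subseteq> X" using K by blast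
    show "\<forall>f\<in>\<Union>\<K>. \<exists>\<epsilon>>0. \<forall>g\<in>X. p (\<lambda>x. g x - f x) < ereal \<epsilon> \<longrightarrow> g \<in> \<Union>\<K>"
    proof
      fix f assume "f \<in> \<Union>\<K>"
      then obtain S where S: "S \<in> \<K>" "f \<in> S" by blast
      with K obtain e where "e > 0" "\<forall>g\<in>X. p (\<lambda>x. g x - f x) < ereal e \<longrightarrow> g \<in> S"
        by blast
      with S show "\<exists>\<epsilon>>0. \<forall>g\<in>X. p (\<lambda>x. g x - f x) < ereal \<epsilon> \<longrightarrow> g \<in> \<Union>\<K>"
        by blast
    qed
  qed
  then show ?thesis by (simp add: norm_topology_def)
qed

text \<open>
  Projective limit of a family of spaces along inclusions: the intersection of the spaces with
  the coarsest topology making the inclusion into each of them continuous.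
\<close>

definition projective_limit :: "nat set \<Rightarrow> (nat \<Rightarrow> 'b topology) \<Rightarrow> 'b topology" where
  "projective_limit I T =
     topology_generated_by {U \<inter> (\<Inter>k\<in>I. topspace (T k)) |U m. m \<in> I \<and> openin (T m) U}"

text \<open>
  A locally convex vector space topology, on the function space \<open>topspace T\<close>. That this space is
  closed under the vector space operations is part of the two continuity conditions.
\<close>

definition locally_convex_topology :: "('a \<Rightarrow> complex) topology \<Rightarrow> bool" where
  "locally_convex_topology T \<longleftrightarrow>
     (\<lambda>x. 0) \<in> topspace T \<and>
     continuous_map (prod_topology T T) T (\<lambda>(f, g). \<lambda>x. f x + g x) \<and>
     continuous_map (prod_topology euclidean T) T (\<lambda>(c, f). \<lambda>x. c * f x) \<and>
     (\<forall>U. openin T U \<and> (\<lambda>x. 0) \<in> U \<longrightarrow>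
       (\<exists>V. openin T V \<and> (\<lambda>x. 0) \<in> V \<and> V \<subseteq> U \<and>
         (\<forall>f\<in>V. \<forall>g\<in>V. \<forall>t\<in>{0..1}.
            (\<lambda>x. complex_of_real (1 - t) * f x + complex_of_real t * g x) \<in> V)))"

text \<open>
  Locally convex inductive limit along inclusions: the union of the spaces with the finest locally
  convex topology making the inclusion of each of them continuous. That topology is the
  supremum of all locally convex topologies with this property, since a supremum of locally convex
  topologies is locally convex.
\<close>

definition lc_inductive_limit ::
    "nat set \<Rightarrow> (nat \<Rightarrow> ('a \<Rightarrow> complex) topology) \<Rightarrow> ('a \<Rightarrow> complex) topology" where
  "lc_inductive_limit I S =
     topology_generated_by {U. \<exists>T. locally_convex_topology T \<and>
       topspace T = (\<Union>n\<in>I. topspace (S n)) \<and>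
       (\<forall>n\<in>I. continuous_map (S n) T (\<lambda>f. f)) \<and> openin T U}"

definition OC_topology :: "(real \<Rightarrow> real) \<Rightarrow> (real ^ 'n::finite \<Rightarrow> complex) topology" where
  "OC_topology \<omega> = lc_inductive_limit {1..} (\<lambda>n. projective_limit {1..}
     (\<lambda>m. norm_topology (O_step \<omega> m n) (O_norm \<omega> m n)))"


section \<open>Multipliers\<close>

definition multipliers ::
    "(real \<Rightarrow> real) \<Rightarrow> (real ^ 'n::finite \<Rightarrow> complex) set \<Rightarrow> (real ^ 'n \<Rightarrow> complex) topology \<Rightarrow>
     (real ^ 'n \<Rightarrow> complex) set" where
  "multipliers \<omega> E T =
     {f \<in> E_space \<omega>. (\<forall>g\<in>E. (\<lambda>x. f x * g x) \<in> E) \<and> continuous_map T T (\<lambda>g x. f x * g x)}"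

end

theory Submission
  imports Defs "HOL-Library.Sublist"
begin

text \<open>
  A multiplier \<open>f\<close> lies in the space because \<open>f = f \<cdot> 1\<close>. Conversely, the Leibniz rule bounds
  \<open>r\<^sub>m\<^sub>,\<^sub>k\<^sub>+\<^sub>n(fg)\<close> by a multiple of \<open>r\<^sub>K\<^sub>m\<^sub>,\<^sub>k(f) r\<^sub>K\<^sub>m\<^sub>,\<^sub>n(g)\<close>: the Young conjugate is superadditive, and passing from
  \<open>m\<close> to \<open>K m\<close> gains a factor \<open>2\<close> to the power \<open>-|\<alpha>|\<close>, which pays for the binomial coefficients. So
  multiplication by \<open>f\<close> is continuous between the steps. It is then continuous on the inductive limit,
  because pulling back an admissible locally convex topology along multiplication by \<open>f\<close> gives another
  admissible one.
\<close>

section \<open>The Leibniz rule\<close>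

text \<open>Each differentiation is charged to one of two factors, and both sublists keep the
  original order. Repeated directions produce repeated pairs, so the binomial coefficients of the
  Leibniz rule appear as multiplicities.\<close>

fun splits :: "'a list \<Rightarrow> ('a list \<times> 'a list) list" where
  "splits [] = [([], [])]"
| "splits (j # js) = map (apfst ((#) j)) (splits js) @ map (apsnd ((#) j)) (splits js)"

lemma length_splits: "length (splits js) = 2 ^ length js"
  by (induction js) auto

lemma splits_subseq:
  assumes "p \<in> set (splits js)"
  shows "subseq (fst p) js" "subseq (snd p) js" "length (fst p) + length (snd p) = length js"
  using assms by (induction js arbitrary: p) auto

lemma has_vector_derivative_sum_list:
  assumes "\<And>p. p \<in> set ps \<Longrightarrow> (u p has_vector_derivative D p) F"
  shows "((\<lambda>t. \<Sum>p\<leftarrow>ps. u p t) has_vector_derivative (\<Sum>p\<leftarrow>ps. D p)) F"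
  using assms by (induction ps) (auto intro!: has_vector_derivative_add)

lemma partial_eqI:
  assumes "\<And>x. ((\<lambda>t. f (x + t *\<^sub>R axis i 1)) has_vector_derivative D x) (at 0)"
  shows "partial i f = D"
  using assms by (auto simp: partial_def fun_eq_iff intro: vector_derivative_at)

lemma smooth_has_partial:
  assumes "smooth f"
  shows "((\<lambda>t. foldr partial js f (x + t *\<^sub>R axis i 1)) has_vector_derivative
           foldr partial (i # js) f x) (at 0)"
  using assms by (simp add: smooth_def partial_def vector_derivative_works)

lemma smooth_continuous: "smooth f \<Longrightarrow> continuous_on A (foldr partial js f)"
  by (auto simp: smooth_def intro: continuous_on_subset)

lemma smoothI:
  assumes "\<And>js. continuous_on UNIV (foldr partial js f)"
    and "\<And>js i x. ((\<lambda>t. foldr partial js f (x + t *\<^sub>R axis i 1)) has_vector_derivative D js i x) (at 0)"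
  shows "smooth f"
  unfolding smooth_def using assms by (blast intro: differentiableI_vector)

text \<open>The product rule applied to each term. It is isolated because it drives the induction
  for the Leibniz rule and also supplies the differentiability in
  \<open>smooth_mult\<close>.\<close>

lemma has_partial_splits:
  assumes "smooth f" "smooth g"
  shows "((\<lambda>t. \<Sum>p\<leftarrow>splits js. foldr partial (fst p) f (x + t *\<^sub>R axis i 1) *
              foldr partial (snd p) g (x + t *\<^sub>R axis i 1)) has_vector_derivative
           (\<Sum>p\<leftarrow>splits (i # js). foldr partial (fst p) f x * foldr partial (snd p) g x)) (at 0)"
proof -
  have "((\<lambda>t. foldr partial (fst p) f (x + t *\<^sub>R axis i 1) *
              foldr partial (snd p) g (x + t *\<^sub>R axis i 1)) has_vector_derivative
           foldr partial (fst p) f x * foldr partial (i # snd p) g x +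
           foldr partial (i # fst p) f x * foldr partial (snd p) g x) (at 0)" for p
    using has_vector_derivative_mult[OF smooth_has_partial[OF assms(1)] smooth_has_partial[OF assms(2)],
        of "fst p" x i "snd p" x i] by simp
  \<comment> \<open>The two summands coming from each pair form the two halves of
    \<open>splits (i # js)\<close>: the direction \<open>i\<close> goes to the left or to the right
    factor.\<close>
  from has_vector_derivative_sum_list[where ps = "splits js", OF this] show ?thesis
    by (simp add: sum_list_addf o_def add.commute)
qed

lemma foldr_partial_mult:
  assumes "smooth f" "smooth g"
  shows "foldr partial js (\<lambda>x. f x * g x) =
    (\<lambda>x. \<Sum>p\<leftarrow>splits js. foldr partial (fst p) f x * foldr partial (snd p) g x)"
proof (induction js)
  case (Cons j js)
  then show ?case
    using partial_eqI[OF has_partial_splits[OF assms]] by simp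
qed simp

lemma smooth_mult:
  assumes "smooth f" "smooth g"
  shows "smooth (\<lambda>x. f x * g x)"
proof (rule smoothI)
  have "continuous_on UNIV (\<lambda>x. \<Sum>p\<leftarrow>ps. foldr partial (fst p) f x * foldr partial (snd p) g x)" for ps
    by (induction ps) (auto intro!: continuous_intros smooth_continuous assms)
  then show "continuous_on UNIV (foldr partial js (\<lambda>x. f x * g x))" for js
    unfolding foldr_partial_mult[OF assms] .
  show "((\<lambda>t. foldr partial js (\<lambda>x. f x * g x) (x + t *\<^sub>R axis i 1)) has_vector_derivative
     (\<Sum>p\<leftarrow>splits (i # js). foldr partial (fst p) f x * foldr partial (snd p) g x)) (at 0)" for js i x
    unfolding foldr_partial_mult[OF assms] by (rule has_partial_splits[OF assms])
qed

section \<open>Differences and constants\<close>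

lemma foldr_partial_diff:
  assumes "smooth f" "smooth g"
  shows "foldr partial js (\<lambda>x. f x - g x) = (\<lambda>x. foldr partial js f x - foldr partial js g x)"
proof (induction js)
  case (Cons j js)
  then show ?case
    using partial_eqI[OF has_vector_derivative_diff[OF smooth_has_partial[OF assms(1), where js = js]
          smooth_has_partial[OF assms(2), where js = js]], of j] by simp
qed simp

text \<open>\<open>norm_topology\<close> measures neighbourhoods by the norm of a difference, while
  the estimates for products require smooth factors.\<close>

lemma smooth_diff:
  assumes "smooth f" "smooth g"
  shows "smooth (\<lambda>x. f x - g x)"
  by (rule smoothI; unfold foldr_partial_diff[OF assms])
    (auto intro!: continuous_intros smooth_continuous assms has_vector_derivative_diff
      smooth_has_partial[OF assms(1)] smooth_has_partial[OF assms(2)] simp del: foldr.simps)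

lemma foldr_partial_const:
  "foldr partial js (\<lambda>x. c) = (\<lambda>x. if js = [] then c else 0)"
proof (induction js)
  case (Cons j js)
  have "partial j (\<lambda>x. d) = (\<lambda>x. 0)" for d
    by (rule partial_eqI) simp
  then show ?case using Cons by simp
qed simp

lemma smooth_const: "smooth (\<lambda>x. c)"
  by (rule smoothI[where D = "\<lambda>_ _ _. 0"]) (auto simp: foldr_partial_const)


section \<open>Multi-indices\<close>

abbreviation index_list :: "('n::finite \<Rightarrow> nat) \<Rightarrow> 'n list" where
  "index_list \<alpha> \<equiv> concat (map (\<lambda>i. replicate (\<alpha> i) i) coordinates)"

lemma coordinates: "distinct (coordinates :: 'n::finite list)" "set (coordinates :: 'n list) = UNIV"
  unfolding coordinates_def
  using someI_ex[of "\<lambda>js. distinct js \<and> set js = (UNIV :: 'n set)"] finite_distinct_list[of "UNIV :: 'n set"]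
  by auto

lemma length_index_list: "length (index_list \<alpha>) = multi_order \<alpha>"
  by (simp add: length_concat o_def multi_order_def sum_list_distinct_conv_sum_set coordinates)

text \<open>This spares us the symmetry of mixed derivatives: the Leibniz rule for an ordered list of
  directions only involves ordered sublists.\<close>

lemma subseq_concat_replicate:
  assumes "distinct cs" "subseq ys (concat (map (\<lambda>i. replicate (\<alpha> i) i) cs))"
  shows "\<exists>\<beta>. ys = concat (map (\<lambda>i. replicate (\<beta> i) i) cs)"
  using assms
proof (induction cs arbitrary: ys)
  case (Cons c cs)
  from Cons.prems(2) obtain ys1 ys2 where ys: "ys = ys1 @ ys2" "subseq ys1 (replicate (\<alpha> c) c)"
    "subseq ys2 (concat (map (\<lambda>i. replicate (\<alpha> i) i) cs))"
    by (auto simp: subseq_append_iff)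
  from Cons.IH[OF _ ys(3)] Cons.prems(1)
  obtain \<beta> where \<beta>: "ys2 = concat (map (\<lambda>i. replicate (\<beta> i) i) cs)" by auto
  from ys(2) obtain I where "ys1 = nths (replicate (\<alpha> c) c) I"
    unfolding subseq_conv_nths by blast
  then have "\<forall>y\<in>set ys1. y = c"
    using set_nths_subset by fastforce
  then obtain k where k: "ys1 = replicate k c"
    using replicate_length_same[of ys1 c, symmetric] by blast
  \<comment> \<open>Since \<open>c\<close> does not occur in \<open>cs\<close>, storing the length
    \<open>k\<close> of the first block at \<open>c\<close> leaves the later blocks
    unchanged.\<close>
  have "map (\<lambda>i. replicate ((\<beta>(c := k)) i) i) cs = map (\<lambda>i. replicate (\<beta> i) i) cs"
    using Cons.prems(1) by (intro map_cong) auto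
  then show ?case
    unfolding ys(1) \<beta> k by (intro exI[of _ "\<beta>(c := k)"]) (simp only: list.map concat.simps fun_upd_same)
qed simp

lemma subseq_index_list:
  assumes "subseq ys (index_list \<alpha>)"
  obtains \<beta> where "ys = index_list \<beta>" "length ys = multi_order \<beta>"
proof -
  obtain \<beta> where "ys = index_list \<beta>" using subseq_concat_replicate[OF coordinates(1) assms] by blast
  then show ?thesis using that length_index_list by blast
qed


section \<open>Seminorm estimates\<close>

lemma nonquasianalytic_weightD:
  assumes "nonquasianalytic_weight \<omega>"
  shows "mono_on {0..} \<omega>" "\<And>t. t \<ge> 0 \<Longrightarrow> 0 \<le> \<omega> t" "\<omega> 1 = 0"
    "\<exists>K\<ge>1. \<forall>t\<ge>0. \<omega> (2 * t) \<le> K * (1 + \<omega> t)"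
  using assms by (auto simp: nonquasianalytic_weight_def)

lemma exp_ereal_infty [simp]: "exp_ereal \<infinity> = \<infinity>" "exp_ereal (- \<infinity>) = 0"
  using exp_ereal.simps(2,3) by (simp_all only: PInfty_eq_infinity MInfty_eq_minfinity)

text \<open>\<open>m\<close> times the conjugate at \<open>j / m\<close> is the supremum of
  \<open>j * t - m * \<omega> (exp t)\<close>; writing the bound as \<open>y / m\<close> clears the
  denominators.\<close>

lemma young_conjugate_le_iff:
  assumes "m \<ge> 1"
  shows "young_conjugate \<omega> (j / real m) \<le> ereal (y / real m) \<longleftrightarrow>
    (\<forall>t\<ge>0. j * t - real m * \<omega> (exp t) \<le> y)"
proof -
  have "j / real m * t - \<omega> (exp t) \<le> y / real m \<longleftrightarrow> j * t - real m * \<omega> (exp t) \<le> y" for t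
    using assms mult_le_cancel_left_pos[of "real m" "j / real m * t - \<omega> (exp t)" "y / real m"]
    by (simp add: right_diff_distrib)
  then show ?thesis by (auto simp: young_conjugate_def SUP_le_iff)
qed

lemma young_conjugate_cases:
  obtains "young_conjugate \<omega> s = \<infinity>" | r where "young_conjugate \<omega> s = ereal r"
proof -
  \<comment> \<open>The competitor \<open>t = 0\<close> in the supremum excludes the value minus
    infinity.\<close>
  have "ereal (- \<omega> 1) \<le> young_conjugate \<omega> s"
    unfolding young_conjugate_def by (rule SUP_upper2[of 0]) auto
  then show ?thesis using that by (cases "young_conjugate \<omega> s") auto
qed

text \<open>This removes the Young conjugate from the seminorms: \<open>y\<close> ranges over the
  upper bounds of \<open>m \<phi>\<^sup>*(j/m)\<close>, of which there are none if this value is infinite.\<close>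

lemma weighted_le_iff:
  assumes "m \<ge> 1" "0 \<le> B"
  shows "ereal c * exp_ereal (- ereal w - ereal (real m) * young_conjugate \<omega> (j / real m)) \<le> ereal B \<longleftrightarrow>
    (\<forall>y. (\<forall>t\<ge>0. j * t - real m * \<omega> (exp t) \<le> y) \<longrightarrow> c \<le> B * exp (w + y))"
proof (cases rule: young_conjugate_cases[of \<omega> "j / real m"])
  case 1
  \<comment> \<open>For an infinite conjugate no \<open>y\<close> is admissible and the right side
    holds vacuously; on the left the weight is \<open>exp_ereal (- \<infinity>) = 0\<close>, and
    \<open>0 \<le> B\<close>.\<close>
  then have "\<not> (\<forall>t\<ge>0. j * t - real m * \<omega> (exp t) \<le> y)" for y
    unfolding young_conjugate_le_iff[OF assms(1), symmetric] by simp
  then have "(\<forall>y. (\<forall>t\<ge>0. j * t - real m * \<omega> (exp t) \<le> y) \<longrightarrow> c \<le> B * exp (w + y)) \<longleftrightarrow> True"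
    by blast
  then show ?thesis using 1 assms by (simp only:) simp
next
  case (2 r)
  have *: "(\<forall>t\<ge>0. j * t - real m * \<omega> (exp t) \<le> y) \<longleftrightarrow> real m * r \<le> y" for y
    unfolding young_conjugate_le_iff[OF assms(1), symmetric] using 2 assms by (simp add: field_simps)
  \<comment> \<open>The least admissible \<open>y\<close> is \<open>real m * r\<close>. At that
    value the bound is the original inequality, and a larger \<open>y\<close> only weakens it
    because \<open>0 \<le> B\<close>.\<close>
  have "c * exp (- w - real m * r) \<le> B \<longleftrightarrow> c \<le> B * exp (w + real m * r)"
    by (simp add: exp_diff exp_minus exp_add field_simps)
  moreover have "B * exp (w + real m * r) \<le> B * exp (w + y)" if "real m * r \<le> y" for y
    using that assms by (intro mult_left_mono) auto
  ultimately show ?thesis unfolding * using 2 by (auto intro: order_trans)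
qed

lemma O_norm_le_iff:
  assumes "m \<ge> 1" "0 \<le> B"
  shows "O_norm \<omega> m n f \<le> ereal B \<longleftrightarrow>
    (\<forall>\<alpha> x y. (\<forall>t\<ge>0. real (multi_order \<alpha>) * t - real m * \<omega> (exp t) \<le> y) \<longrightarrow>
       cmod (multi_partial \<alpha> f x) \<le> B * exp (real n * \<omega> (norm x) + y))"
  unfolding O_norm_def SUP_le_iff weighted_le_iff[OF assms] by blast

lemma E_seminorm_le_iff:
  assumes "m \<ge> 1" "0 \<le> B"
  shows "E_seminorm \<omega> K m f \<le> ereal B \<longleftrightarrow>
    (\<forall>x\<in>K. \<forall>\<alpha> y. (\<forall>t\<ge>0. real (multi_order \<alpha>) * t - real m * \<omega> (exp t) \<le> y) \<longrightarrow>
       cmod (multi_partial \<alpha> f x) \<le> B * exp y)"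
  using weighted_le_iff[OF assms, where w = 0]
  by (simp add: E_seminorm_def SUP_le_iff zero_ereal_def[symmetric])

lemma O_norm_nonneg: "0 \<le> O_norm \<omega> m n f"
proof -
  have "0 \<le> exp_ereal z" for z by (cases z) auto
  then show ?thesis
    unfolding O_norm_def by (auto intro!: SUP_upper2[where i = undefined])
qed

lemma O_normE:
  assumes "O_norm \<omega> m n f < \<infinity>"
  obtains B where "0 < B" "O_norm \<omega> m n f \<le> ereal B"
proof -
  obtain B where "O_norm \<omega> m n f = ereal B"
    using assms O_norm_nonneg[of \<omega> m n f] by (cases "O_norm \<omega> m n f") auto
  then show ?thesis using that[of "max 1 B"] by auto
qed

text \<open>The gain \<open>(i + j) ln 2\<close> comes from shifting \<open>t\<close> by \<open>ln 2\<close> in condition (\<open>\<alpha>\<close>).\<close>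

lemma young_bound_split:
  assumes \<omega>: "nonquasianalytic_weight \<omega>" and K: "\<And>t. t \<ge> 0 \<Longrightarrow> \<omega> (2 * t) \<le> real K * (1 + \<omega> t)"
    and y: "\<And>t. t \<ge> 0 \<Longrightarrow> real (i + j) * t - real m * \<omega> (exp t) \<le> y"
  obtains p q where "\<And>t. t \<ge> 0 \<Longrightarrow> real i * t - real (K * m) * \<omega> (exp t) \<le> p"
    "\<And>t. t \<ge> 0 \<Longrightarrow> real j * t - real (K * m) * \<omega> (exp t) \<le> q"
    "p + q + real (i + j) * ln 2 \<le> y + real (K * m)"
proof -
  note nn = nonquasianalytic_weightD(2)[OF \<omega>]
  \<comment> \<open>\<open>r\<close> is what the hypothesis at \<open>t + ln 2\<close> leaves for
    \<open>t\<close> after one use of (\<alpha>) and after setting aside the gain.\<close>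
  define r where "r = y + real (K * m) - real (i + j) * ln 2"
  have r: "real (i + j) * t - real (K * m) * \<omega> (exp t) \<le> r" if "t \<ge> 0" for t
  proof -
    have "real m * \<omega> (exp (t + ln 2)) \<le> real m * (real K * (1 + \<omega> (exp t)))"
      using K[of "exp t"] by (intro mult_left_mono) (auto simp: exp_add mult.commute)
    then show ?thesis using y[of "t + ln 2"] that by (simp add: r_def algebra_simps)
  qed
  show ?thesis
  proof (cases "i + j = 0")
    \<comment> \<open>There are no proportions \<open>i / (i + j)\<close> here. Zero bounds suffice
      since \<omega> is nonnegative, and \<open>t = 0\<close> with \<open>\<omega> 1 = 0\<close>
      gives \<open>0 \<le> y\<close>.\<close>
    case True
    have "0 \<le> y" using y[of 0] nonquasianalytic_weightD(3)[OF \<omega>] by simp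
    then show ?thesis using True by (intro that[of 0 0]) (auto intro!: mult_nonneg_nonneg nn)
  next
    case False
    \<comment> \<open>Superadditivity of the conjugate: scaling the bound by the share
      \<open>l / (i + j)\<close>, which is at most 1, only shrinks the nonnegative weight term. The
      shares of \<open>i\<close> and \<open>j\<close> add up to \<open>r\<close>.\<close>
    have *: "real l * t - real (K * m) * \<omega> (exp t) \<le> real l / real (i + j) * r"
      if "t \<ge> 0" "l \<le> i + j" for l t
    proof -
      have "real l / real (i + j) * (real (i + j) * t - real (K * m) * \<omega> (exp t)) \<le> real l / real (i + j) * r"
        using r[OF that(1)] by (intro mult_left_mono) auto
      moreover have "real l / real (i + j) * (real (K * m) * \<omega> (exp t)) \<le> 1 * (real (K * m) * \<omega> (exp t))"
        using that False by (intro mult_right_mono) (auto intro!: mult_nonneg_nonneg nn)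
      ultimately show ?thesis using False by (simp add: right_diff_distrib)
    qed
    have "real i / real (i + j) * r + real j / real (i + j) * r = r"
      using False by (simp add: add_divide_distrib[symmetric] distrib_right[symmetric]
          of_nat_add[symmetric] del: of_nat_add)
    then have "real i / real (i + j) * r + real j / real (i + j) * r + real (i + j) * ln 2 \<le> y + real (K * m)"
      unfolding r_def by linarith
    then show ?thesis
      by (intro that[of "real i / real (i + j) * r" "real j / real (i + j) * r"])
        (use * in \<open>auto simp del: of_nat_mult of_nat_add\<close>)
  qed
qed

text \<open>A Leibniz sum of order \<open>N\<close> has \<open>2 ^ N\<close> terms, and passing from
  \<open>m\<close> to \<open>K * m\<close> gains the factor \<open>2 ^ N\<close> in each of them.
  The constant \<open>exp (real (K * m))\<close> stems from the additive 1 in (\<alpha>), and the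
  growth exponents \<open>k\<close> and \<open>n\<close> add because the weights multiply.\<close>

lemma O_norm_mult:
  assumes \<omega>: "nonquasianalytic_weight \<omega>" and K: "\<And>t. t \<ge> 0 \<Longrightarrow> \<omega> (2 * t) \<le> real K * (1 + \<omega> t)"
    and "K \<ge> 1" "m \<ge> 1" and "smooth (f :: real ^ 'n::finite \<Rightarrow> complex)" "smooth g"
    and A: "0 \<le> A" "O_norm \<omega> (K * m) k f \<le> ereal A"
    and B: "0 \<le> B" "O_norm \<omega> (K * m) n g \<le> ereal B"
  shows "O_norm \<omega> m (k + n) (\<lambda>x. f x * g x) \<le> ereal (A * exp (real (K * m)) * B)"
proof -
  have "0 \<le> A * exp (real (K * m)) * B" using A B by simp
  have m': "K * m \<ge> 1" using assms(3,4) by simp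
  show ?thesis
    unfolding O_norm_le_iff[OF \<open>m \<ge> 1\<close> \<open>0 \<le> A * exp (real (K * m)) * B\<close>]
  proof (intro allI impI)
    fix \<alpha> :: "'n \<Rightarrow> nat" and x :: "real ^ 'n" and y
    assume y: "\<forall>t\<ge>0. real (multi_order \<alpha>) * t - real m * \<omega> (exp t) \<le> y"
    define N where "N = multi_order \<alpha>"
    \<comment> \<open>A bound common to all pairs of the Leibniz sum; the term
      \<open>- real N * ln 2\<close> will cancel the number of pairs.\<close>
    define W where "W = A * B * exp (real (k + n) * \<omega> (norm x) + y + real (K * m) - real N * ln 2)"
    have W: "cmod (foldr partial (fst p) f x * foldr partial (snd p) g x) \<le> W"
      if p: "p \<in> set (splits (index_list \<alpha>))" for p
    proof -
      \<comment> \<open>Sublists of an index list are again index lists, so the norms of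
        \<open>f\<close> and \<open>g\<close>, which see only multi-indices, control both
        factors.\<close>
      obtain \<beta> where \<beta>: "fst p = index_list \<beta>" "length (fst p) = multi_order \<beta>"
        using subseq_index_list splits_subseq(1)[OF p] by blast
      obtain \<gamma> where \<gamma>: "snd p = index_list \<gamma>" "length (snd p) = multi_order \<gamma>"
        using subseq_index_list splits_subseq(2)[OF p] by blast
      have N: "multi_order \<beta> + multi_order \<gamma> = N"
        using splits_subseq(3)[OF p] \<beta> \<gamma> by (simp add: length_index_list N_def)
      obtain u v where u: "\<And>t. t \<ge> 0 \<Longrightarrow> real (multi_order \<beta>) * t - real (K * m) * \<omega> (exp t) \<le> u"
        and v: "\<And>t. t \<ge> 0 \<Longrightarrow> real (multi_order \<gamma>) * t - real (K * m) * \<omega> (exp t) \<le> v"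
        and uv: "u + v + real N * ln 2 \<le> y + real (K * m)"
        using young_bound_split[OF \<omega> K, of "multi_order \<beta>" "multi_order \<gamma>" m y] y
        unfolding N N_def by blast
      have f: "cmod (multi_partial \<beta> f x) \<le> A * exp (real k * \<omega> (norm x) + u)"
        using A(2) u unfolding O_norm_le_iff[OF m' A(1)] by blast
      have g: "cmod (multi_partial \<gamma> g x) \<le> B * exp (real n * \<omega> (norm x) + v)"
        using B(2) v unfolding O_norm_le_iff[OF m' B(1)] by blast
      have "cmod (multi_partial \<beta> f x * multi_partial \<gamma> g x) \<le>
          (A * exp (real k * \<omega> (norm x) + u)) * (B * exp (real n * \<omega> (norm x) + v))"
        unfolding norm_mult using A B by (intro mult_mono f g) auto
      also have "\<dots> = A * B * exp (real (k + n) * \<omega> (norm x) + (u + v))"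
        by (simp add: exp_add algebra_simps)
      also have "\<dots> \<le> W"
        unfolding W_def using uv A B by (intro mult_left_mono) auto
      finally show ?thesis by (simp add: multi_partial_def \<beta>(1) \<gamma>(1))
    qed
    \<comment> \<open>Generalized to arbitrary lists of such pairs, because the induction drops
      entries.\<close>
    have "cmod (\<Sum>p\<leftarrow>ps. foldr partial (fst p) f x * foldr partial (snd p) g x) \<le> real (length ps) * W"
      if "set ps \<subseteq> set (splits (index_list \<alpha>))" for ps
      using that
    proof (induction ps)
      case (Cons p ps)
      then show ?case
        using W[of p] norm_triangle_ineq[of "foldr partial (fst p) f x * foldr partial (snd p) g x"
            "\<Sum>p\<leftarrow>ps. foldr partial (fst p) f x * foldr partial (snd p) g x"]
        by (simp add: distrib_right)
    qed simp
    from this[OF order_refl]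
    have "cmod (multi_partial \<alpha> (\<lambda>x. f x * g x) x) \<le> 2 ^ N * W"
      by (simp add: multi_partial_def foldr_partial_mult[OF assms(5,6)] length_splits
          length_index_list N_def)
    also have "(2::real) ^ N = exp (real N * ln 2)"
      by (simp add: exp_of_nat_mult)
    also have "exp (real N * ln 2) * W = A * exp (real (K * m)) * B * exp (real (k + n) * \<omega> (norm x) + y)"
      unfolding W_def by (simp add: exp_add exp_diff)
    finally show "cmod (multi_partial \<alpha> (\<lambda>x. f x * g x) x) \<le>
        A * exp (real (K * m)) * B * exp (real (k + n) * \<omega> (norm x) + y)" .
  qed
qed

section \<open>Products of the steps and of their union\<close>

definition OC_step :: "(real \<Rightarrow> real) \<Rightarrow> nat \<Rightarrow> (real ^ 'n::finite \<Rightarrow> complex) set" where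
  "OC_step \<omega> n = (\<Inter>m\<in>{1..}. O_step \<omega> m n)"

lemma OC_space_eq: "OC_space \<omega> = (\<Union>n\<in>{1..}. OC_step \<omega> n)"
  by (simp add: OC_space_def OC_step_def)

lemma O_step_smooth: "f \<in> O_step \<omega> m n \<Longrightarrow> smooth f"
  by (simp add: O_step_def)

text \<open>\<open>m'\<close> and \<open>C\<close> are fixed before \<open>g\<close> and
  \<open>n\<close>. This uniformity makes multiplication by \<open>f\<close> a bounded linear
  operator between norms, which is what continuity uses later.\<close>

lemma O_norm_mult_left:
  assumes \<omega>: "nonquasianalytic_weight \<omega>" and f: "(f :: real ^ 'n::finite \<Rightarrow> complex) \<in> OC_step \<omega> k" and "m \<ge> 1"
  obtains m' C where "m' \<ge> 1" "0 < C"
    "\<And>(g :: real ^ 'n \<Rightarrow> complex) n. smooth g \<Longrightarrow> O_norm \<omega> m (k + n) (\<lambda>x. f x * g x) \<le> ereal C * O_norm \<omega> m' n g"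
proof -
  obtain L where L: "L \<ge> 1" "\<And>t. t \<ge> 0 \<Longrightarrow> \<omega> (2 * t) \<le> L * (1 + \<omega> t)"
    using nonquasianalytic_weightD(4)[OF \<omega>] by blast
  \<comment> \<open>\<open>K * m\<close> must be the index of a norm, so the constant of (\<alpha>)
    is rounded up; the inequality survives because \<open>1 + \<omega> t\<close> is
    nonnegative.\<close>
  define K where "K = nat \<lceil>L\<rceil>"
  have "K \<ge> 1" using L(1) by (simp add: K_def le_nat_iff)
  have "L \<le> real K" by (simp add: K_def real_nat_ceiling_ge)
  then have K: "\<omega> (2 * t) \<le> real K * (1 + \<omega> t)" if "t \<ge> 0" for t
    using L(2)[OF that] mult_right_mono[of L "real K" "1 + \<omega> t"] nonquasianalytic_weightD(2)[OF \<omega> that]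
    by linarith
  have m': "K * m \<ge> 1" using \<open>K \<ge> 1\<close> \<open>m \<ge> 1\<close> by simp
  with f have "f \<in> O_step \<omega> (K * m) k" by (simp add: OC_step_def)
  then have f': "smooth f" "O_norm \<omega> (K * m) k f < \<infinity>" by (auto simp: O_step_def)
  obtain A where A: "0 < A" "O_norm \<omega> (K * m) k f \<le> ereal A" using O_normE[OF f'(2)] .
  show ?thesis
  proof (rule that[OF m'])
    show "0 < A * exp (real (K * m))" using A by simp
    fix g :: "real ^ 'n \<Rightarrow> complex" and n assume g: "smooth g"
    show "O_norm \<omega> m (k + n) (\<lambda>x. f x * g x) \<le> ereal (A * exp (real (K * m))) * O_norm \<omega> (K * m) n g"
    proof (cases "O_norm \<omega> (K * m) n g")
      case (real B)
      then show ?thesis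
        using O_norm_mult[OF \<omega> K \<open>K \<ge> 1\<close> \<open>m \<ge> 1\<close> f'(1) g _ A(2), of B n] A
          O_norm_nonneg[of \<omega> "K * m" n g] by simp
    next
      case PInf
      then show ?thesis using A by simp
    next
      case MInf
      then show ?thesis using O_norm_nonneg[of \<omega> "K * m" n g] by simp
    qed
  qed
qed

lemma OC_step_mult:
  assumes "nonquasianalytic_weight \<omega>" "f \<in> OC_step \<omega> k" "g \<in> OC_step \<omega> n"
  shows "(\<lambda>x. f x * g x) \<in> OC_step \<omega> (k + n)"
  unfolding OC_step_def
proof
  fix m :: nat assume "m \<in> {1..}"
  then obtain m' C where m': "m' \<ge> 1" "0 < C"
    "\<And>g n. smooth g \<Longrightarrow> O_norm \<omega> m (k + n) (\<lambda>x. f x * g x) \<le> ereal C * O_norm \<omega> m' n g"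
    using O_norm_mult_left[OF assms(1,2), of m] by auto
  have g: "smooth g" "O_norm \<omega> m' n g < \<infinity>"
    using assms(3) m'(1) by (auto simp: OC_step_def O_step_def)
  have f: "smooth f" using assms(2) by (auto simp: OC_step_def O_step_def)
  obtain B where B: "O_norm \<omega> m' n g \<le> ereal B" using O_normE[OF g(2)] by blast
  have "O_norm \<omega> m (k + n) (\<lambda>x. f x * g x) \<le> ereal C * ereal B"
    using m'(3)[OF g(1), of n] m'(2) ereal_mult_left_mono[OF B, of "ereal C"] by (auto intro: order_trans)
  then have "O_norm \<omega> m (k + n) (\<lambda>x. f x * g x) < \<infinity>" by (auto intro: le_less_trans)
  then show "(\<lambda>x. f x * g x) \<in> O_step \<omega> m (k + n)"
    by (simp add: O_step_def smooth_mult f g(1))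
qed

lemma OC_space_mult:
  assumes "nonquasianalytic_weight \<omega>" "f \<in> OC_space \<omega>" "g \<in> OC_space \<omega>"
  shows "(\<lambda>x. f x * g x) \<in> OC_space \<omega>"
proof -
  obtain k n where "k \<ge> 1" "n \<ge> 1" "f \<in> OC_step \<omega> k" "g \<in> OC_step \<omega> n"
    using assms by (auto simp: OC_space_eq)
  then show ?thesis
    using OC_step_mult[OF assms(1)] by (force simp: OC_space_eq intro!: bexI[of _ "k + n"])
qed

section \<open>The constant 1 and the inclusion into the ultradifferentiable functions\<close>

lemma const_in_OC_space:
  assumes "nonquasianalytic_weight \<omega>"
  shows "(\<lambda>x. 1) \<in> (OC_space \<omega> :: (real ^ 'n::finite \<Rightarrow> complex) set)"
proof -
  have "O_norm \<omega> m 1 (\<lambda>x :: real ^ 'n. 1) \<le> ereal 1" if "m \<ge> 1" for m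
    unfolding O_norm_le_iff[OF that zero_le_one]
  proof (intro allI impI)
    fix \<alpha> :: "'n \<Rightarrow> nat" and x :: "real ^ 'n" and y
    assume y: "\<forall>t\<ge>0. real (multi_order \<alpha>) * t - real m * \<omega> (exp t) \<le> y"
    \<comment> \<open>By the normalization at \<open>t = 0\<close> every admissible \<open>y\<close>
      is nonnegative, so the weight is at least 1.\<close>
    have "0 \<le> y" using y[rule_format, of 0] nonquasianalytic_weightD(3)[OF assms] by simp
    then have "1 \<le> exp (real 1 * \<omega> (norm x) + y)"
      using nonquasianalytic_weightD(2)[OF assms, of "norm x"] by simp
    moreover have "cmod (multi_partial \<alpha> (\<lambda>x. 1) x) \<le> 1"
      by (simp add: multi_partial_def foldr_partial_const)
    ultimately show "cmod (multi_partial \<alpha> (\<lambda>x. 1) x) \<le> 1 * exp (real 1 * \<omega> (norm x) + y)"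
      by linarith
  qed
  then have "O_norm \<omega> m 1 (\<lambda>x :: real ^ 'n. 1) < \<infinity>" if "m \<ge> 1" for m
    using le_less_trans[of _ "ereal 1" \<infinity>] that by simp
  then have "(\<lambda>x :: real ^ 'n. 1) \<in> O_step \<omega> m 1" if "m \<ge> 1" for m
    using that by (simp add: O_step_def smooth_const)
  then show ?thesis by (auto simp: OC_space_def)
qed

text \<open>Membership in \<open>E_space\<close> is part of being a multiplier. On a compact set of
  radius \<open>R\<close>, monotonicity of \<omega> absorbs the growth factor into the constant
  \<open>exp (real n * \<omega> R)\<close>.\<close>

lemma OC_space_subset_E_space:
  assumes "nonquasianalytic_weight \<omega>"
  shows "(OC_space \<omega> :: (real ^ 'n::finite \<Rightarrow> complex) set) \<subseteq> E_space \<omega>"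
proof
  fix f :: "real ^ 'n \<Rightarrow> complex" assume "f \<in> OC_space \<omega>"
  then obtain n where n: "\<And>m. m \<ge> 1 \<Longrightarrow> f \<in> O_step \<omega> m n"
    by (auto simp: OC_space_def)
  have "E_seminorm \<omega> K m f < \<infinity>" if K: "compact K" and m: "m \<ge> 1" for K m
  proof -
    obtain R where R: "\<And>x. x \<in> K \<Longrightarrow> norm x \<le> R"
      using compact_imp_bounded[OF K] by (auto simp: bounded_iff)
    obtain B where B: "0 < B" "O_norm \<omega> m n f \<le> ereal B"
      using n[OF m] O_normE[of \<omega> m n f] by (auto simp: O_step_def)
    have "0 \<le> B * exp (real n * \<omega> R)" using B by simp
    have "E_seminorm \<omega> K m f \<le> ereal (B * exp (real n * \<omega> R))"
      unfolding E_seminorm_le_iff[OF m \<open>0 \<le> B * exp (real n * \<omega> R)\<close>]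
    proof (intro ballI allI impI)
      fix x and \<alpha> :: "'n \<Rightarrow> nat" and y assume x: "x \<in> K"
        and y: "\<forall>t\<ge>0. real (multi_order \<alpha>) * t - real m * \<omega> (exp t) \<le> y"
      have "\<omega> (norm x) \<le> \<omega> R"
        using R[OF x] order_trans[OF norm_ge_zero R[OF x]]
        by (intro mono_onD[OF nonquasianalytic_weightD(1)[OF assms]]) auto
      then have "exp (real n * \<omega> (norm x) + y) \<le> exp (real n * \<omega> R + y)"
        by (simp add: mult_left_mono)
      then have "B * exp (real n * \<omega> (norm x) + y) \<le> B * exp (real n * \<omega> R + y)"
        using B by (intro mult_left_mono) auto
      moreover have "cmod (multi_partial \<alpha> f x) \<le> B * exp (real n * \<omega> (norm x) + y)"
        using B(2) y unfolding O_norm_le_iff[OF m less_imp_le[OF B(1)]] by blast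
      ultimately show "cmod (multi_partial \<alpha> f x) \<le> B * exp (real n * \<omega> R) * exp y"
        by (simp add: exp_add mult.assoc)
    qed
    then show ?thesis by (auto intro: le_less_trans)
  qed
  then show "f \<in> E_space \<omega>"
    using O_step_smooth[OF n[of 1]] by (simp add: E_space_def)
qed


section \<open>Continuity of multiplication operators\<close>

lemma topspace_norm_topology [simp]: "topspace (norm_topology X p) = X"
proof
  show "topspace (norm_topology X p) \<subseteq> X"
    unfolding topspace_def openin_norm_topology by blast
  have "openin (norm_topology X p) X"
    unfolding openin_norm_topology using zero_less_one by blast
  then show "X \<subseteq> topspace (norm_topology X p)" by (rule openin_subset)
qed

text \<open>The carrier of a generated topology is the union of its generators, which is empty for
  an empty index set.\<close>

lemma topspace_projective_limit:
  assumes "I \<noteq> {}"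
  shows "topspace (projective_limit I T) = (\<Inter>k\<in>I. topspace (T k))"
  using assms unfolding projective_limit_def topology_generated_by_topspace by blast

section \<open>Pullbacks and the inductive limit\<close>

text \<open>Multiplication by \<open>h\<close> is linear, so it commutes with sums, scalar multiples
  and convex combinations; each axiom for the pullback reduces to the same axiom for
  \<open>T\<close>.\<close>

lemma locally_convex_pullback:
  fixes h :: "'a \<Rightarrow> complex"
  assumes T: "locally_convex_topology T"
    and h: "\<And>g. g \<in> topspace T \<Longrightarrow> (\<lambda>x. h x * g x) \<in> topspace T"
  shows "locally_convex_topology (pullback_topology (topspace T) (\<lambda>g x. h x * g x) T)"
    (is "locally_convex_topology ?P")
proof -
  let ?M = "\<lambda>g x. h x * g x"
  have top: "topspace ?P = topspace T" using h by (auto simp: topspace_pullback_topology)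
  have M: "continuous_map ?P T ?M"
    by (rule continuous_map_pullback[OF continuous_map_id, unfolded id_o id_comp])
  have zero: "(\<lambda>x. 0) \<in> topspace T"
    and add: "continuous_map (prod_topology T T) T (\<lambda>(f, g). \<lambda>x. f x + g x)"
    and scale: "continuous_map (prod_topology euclidean T) T (\<lambda>(c, f). \<lambda>x. c * f x)"
    and conv: "\<And>U. openin T U \<Longrightarrow> (\<lambda>x. 0) \<in> U \<Longrightarrow>
       (\<exists>V. openin T V \<and> (\<lambda>x. 0) \<in> V \<and> V \<subseteq> U \<and>
         (\<forall>f\<in>V. \<forall>g\<in>V. \<forall>t\<in>{0..1}.
            (\<lambda>x. complex_of_real (1 - t) * f x + complex_of_real t * g x) \<in> V))"
    using T unfolding locally_convex_topology_def by blast+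
  have addT: "(\<lambda>x. f x + g x) \<in> topspace T" if "f \<in> topspace T" "g \<in> topspace T" for f g
    using continuous_map_image_subset_topspace[OF add] that by auto
  have scaleT: "(\<lambda>x. c * f x) \<in> topspace T" if "f \<in> topspace T" for f c
    using continuous_map_image_subset_topspace[OF scale] that by auto
  show ?thesis
    unfolding locally_convex_topology_def
  proof (intro conjI allI impI)
    show "(\<lambda>x. 0) \<in> topspace ?P" using zero top by simp
    show "continuous_map (prod_topology ?P ?P) ?P (\<lambda>(f, g). \<lambda>x. f x + g x)"
    proof (rule continuous_map_pullback')
      \<comment> \<open>Continuity into a pullback is tested after \<open>?M\<close>, and by
        distributivity \<open>?M\<close> can act on the summands before they are added.\<close>
      have "continuous_map (prod_topology ?P ?P) T
          ((\<lambda>(f, g). \<lambda>x. f x + g x) \<circ> (\<lambda>(f, g). (?M f, ?M g)))"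
        by (intro continuous_map_compose[OF _ add] iffD2[OF continuous_map_prod_top] disjI2 conjI M)
      then show "continuous_map (prod_topology ?P ?P) T (?M \<circ> (\<lambda>(f, g). \<lambda>x. f x + g x))"
        by (simp add: o_def case_prod_unfold distrib_left)
    qed (auto simp: top addT)
    show "continuous_map (prod_topology euclidean ?P) ?P (\<lambda>(c, f). \<lambda>x. c * f x)"
    proof (rule continuous_map_pullback')
      have "continuous_map (prod_topology euclidean ?P) T
          ((\<lambda>(c, f). \<lambda>x. c * f x) \<circ> (\<lambda>(c, f). (c, ?M f)))"
        by (intro continuous_map_compose[OF _ scale] iffD2[OF continuous_map_prod_top] disjI2 conjI M)
          simp
      then show "continuous_map (prod_topology euclidean ?P) T (?M \<circ> (\<lambda>(c, f). \<lambda>x. c * f x))"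
        by (simp add: o_def case_prod_unfold mult.left_commute)
    qed (auto simp: top scaleT)
    fix U assume "openin ?P U \<and> (\<lambda>x. 0) \<in> U"
    then obtain U' where U': "openin T U'" "U = ?M -` U' \<inter> topspace T" and "(\<lambda>x. 0) \<in> U"
      by (auto simp: openin_pullback_topology)
    then have "(\<lambda>x. 0) \<in> U'" by simp
    then obtain V where V: "openin T V" "(\<lambda>x. 0) \<in> V" "V \<subseteq> U'"
      "\<And>f g t. f \<in> V \<Longrightarrow> g \<in> V \<Longrightarrow> t \<in> {0..1} \<Longrightarrow>
            (\<lambda>x. complex_of_real (1 - t) * f x + complex_of_real t * g x) \<in> V"
      using conv[OF U'(1)] by blast
    show "\<exists>V. openin ?P V \<and> (\<lambda>x. 0) \<in> V \<and> V \<subseteq> U \<and>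
         (\<forall>f\<in>V. \<forall>g\<in>V. \<forall>t\<in>{0..1}.
            (\<lambda>x. complex_of_real (1 - t) * f x + complex_of_real t * g x) \<in> V)"
    \<comment> \<open>The preimage of a convex neighbourhood under a linear map is convex.\<close>
    proof (intro exI[of _ "?M -` V \<inter> topspace T"] conjI ballI)
      show "openin ?P (?M -` V \<inter> topspace T)" using V(1) by (auto simp: openin_pullback_topology)
      show "(\<lambda>x. 0) \<in> ?M -` V \<inter> topspace T" using V(2) zero by simp
      show "?M -` V \<inter> topspace T \<subseteq> U" using V(3) U'(2) by auto
      fix f g t assume *: "f \<in> ?M -` V \<inter> topspace T" "g \<in> ?M -` V \<inter> topspace T" "t \<in> {0..1::real}"
      have "(\<lambda>x. complex_of_real (1 - t) * f x + complex_of_real t * g x) \<in> topspace T"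
        using * by (intro addT scaleT) auto
      moreover have "?M (\<lambda>x. complex_of_real (1 - t) * f x + complex_of_real t * g x) \<in> V"
        using V(4)[of "?M f" "?M g" t] * by (simp add: algebra_simps)
      ultimately show "(\<lambda>x. complex_of_real (1 - t) * f x + complex_of_real t * g x) \<in> ?M -` V \<inter> topspace T"
        by simp
    qed
  qed
qed

text \<open>The limit topology is generated by the open sets of all admissible topologies, so only
  their preimages need checking. The operator may move step \<open>n\<close> to another step
  \<open>n'\<close>.\<close>

lemma continuous_map_lc_inductive_limit_mult:
  assumes "\<And>g. g \<in> (\<Union>n\<in>I. topspace (S n)) \<Longrightarrow> (\<lambda>x. h x * g x) \<in> (\<Union>n\<in>I. topspace (S n))"
    and cont: "\<And>n. n \<in> I \<Longrightarrow> \<exists>n'\<in>I. continuous_map (S n) (S n') (\<lambda>g x. h x * g x)"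
  shows "continuous_map (lc_inductive_limit I S) (lc_inductive_limit I S) (\<lambda>g x. h x * g x)"
proof -
  let ?M = "\<lambda>g x. h x * g x"
  define X where "X = (\<Union>n\<in>I. topspace (S n))"
  have MX: "?M g \<in> X" if "g \<in> X" for g using assms(1) that unfolding X_def by blast
  have SX: "topspace (S n) \<subseteq> X" if "n \<in> I" for n using that unfolding X_def by blast
  let ?P = "\<lambda>T. locally_convex_topology T \<and> topspace T = X \<and> (\<forall>n\<in>I. continuous_map (S n) T (\<lambda>f. f))"
  have L: "lc_inductive_limit I S = topology_generated_by {U. \<exists>T. ?P T \<and> openin T U}"
    unfolding lc_inductive_limit_def X_def by (simp only: conj_assoc)
  have pull: "openin (lc_inductive_limit I S) (?M -` U \<inter> X)" if T: "?P T" "openin T U" for T U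
  proof -
    let ?T = "pullback_topology X ?M T"
    have "locally_convex_topology ?T"
      using locally_convex_pullback[of T h] MX T(1) by simp
    moreover have "topspace ?T = X"
      using MX T(1) by (auto simp: topspace_pullback_topology)
    moreover have "continuous_map (S n) ?T (\<lambda>f. f)" if n: "n \<in> I" for n
    proof (rule continuous_map_pullback')
      obtain n' where n': "n' \<in> I" "continuous_map (S n) (S n') ?M" using cont[OF n] by blast
      \<comment> \<open>The pullback is admissible because multiplication sends step
        \<open>n\<close> continuously into step \<open>n'\<close>, whose inclusion into
        \<open>T\<close> is continuous.\<close>
      have "continuous_map (S n) T ((\<lambda>f. f) \<circ> ?M)"
        using n' T(1) by (intro continuous_map_compose[OF n'(2)]) blast
      then show "continuous_map (S n) T (?M \<circ> (\<lambda>f. f))" by (simp add: o_def)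
      show "topspace (S n) \<subseteq> (\<lambda>f. f) -` X" using SX[OF n] by auto
    qed
    ultimately have "?P ?T" by blast
    moreover have "openin ?T (?M -` U \<inter> X)"
      using T(2) unfolding openin_pullback_topology by blast
    ultimately show ?thesis
      unfolding L by (intro topology_generated_by_Basis) blast
  qed
  show ?thesis
    apply (subst (2) L)
  proof (rule continuous_on_generated_topo)
    fix U assume "U \<in> {U. \<exists>T. ?P T \<and> openin T U}"
    then obtain T where T: "?P T" "openin T U" by blast
    \<comment> \<open>That the generated topology has carrier \<open>X\<close> relies on the
      existence of an admissible topology; the \<open>T\<close> at hand provides one.\<close>
    have "topspace (lc_inductive_limit I S) = X"
    proof
      show "topspace (lc_inductive_limit I S) \<subseteq> X"
        unfolding L topology_generated_by_topspace using openin_subset by blast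
      have "openin T X" using T(1) openin_topspace[of T] by simp
      then show "X \<subseteq> topspace (lc_inductive_limit I S)"
        unfolding L topology_generated_by_topspace using T(1) by blast
    qed
    then show "openin (lc_inductive_limit I S) (?M -` U \<inter> topspace (lc_inductive_limit I S))"
      using pull[OF T] by simp
  next
    show "?M ` topspace (lc_inductive_limit I S) \<subseteq> \<Union> {U. \<exists>T. ?P T \<and> openin T U}"
    proof
      fix g assume "g \<in> ?M ` topspace (lc_inductive_limit I S)"
      then obtain f U T where f: "g = ?M f" "f \<in> U" "?P T" "openin T U"
        unfolding L topology_generated_by_topspace by blast
      then have "f \<in> X" using openin_subset[OF f(4)] by blast
      then have "g \<in> topspace T" using MX[of f] f(1,3) by simp
      then show "g \<in> \<Union> {U. \<exists>T. ?P T \<and> openin T U}" using f(3) openin_topspace[of T] by blast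
    qed
  qed
qed

section \<open>Continuity on the steps and on the whole space\<close>

text \<open>A generating open set of the target involves one norm index \<open>m\<close>, and its
  preimage is already open for the single norm with index \<open>m'\<close> on the source.\<close>

lemma continuous_map_step_mult:
  fixes \<omega> :: "real \<Rightarrow> real"
  defines "S \<equiv> \<lambda>n. projective_limit {1..}
    (\<lambda>m. norm_topology (O_step \<omega> m n :: (real ^ 'n::finite \<Rightarrow> complex) set) (O_norm \<omega> m n))"
  assumes \<omega>: "nonquasianalytic_weight \<omega>" and f: "(f :: real ^ 'n::finite \<Rightarrow> complex) \<in> OC_step \<omega> k"
  shows "continuous_map (S n) (S (k + n)) (\<lambda>g x. f x * g x)"
proof -
  let ?M = "\<lambda>g x. f x * g x"
  let ?G = "\<lambda>n. {U \<inter> (\<Inter>m\<in>{1..}. O_step \<omega> m n :: (real ^ 'n \<Rightarrow> complex) set) |U m. m \<in> {1..} \<and>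
      openin (norm_topology (O_step \<omega> m n) (O_norm \<omega> m n)) U}"
  have S: "S n = topology_generated_by (?G n)" for n
    by (simp add: S_def projective_limit_def)
  have top: "topspace (S n) = OC_step \<omega> n" for n
    unfolding S_def by (subst topspace_projective_limit) (auto simp: OC_step_def)
  show ?thesis
    apply (subst (2) S)
  proof (rule continuous_on_generated_topo)
    fix U assume "U \<in> ?G (k + n)"
    then obtain U' m where U: "U = U' \<inter> OC_step \<omega> (k + n)" and m: "m \<ge> 1"
      and U': "openin (norm_topology (O_step \<omega> m (k + n)) (O_norm \<omega> m (k + n))) U'"
      by (auto simp: OC_step_def)
    obtain m' C where m': "m' \<ge> 1" and C: "0 < C"
      and M: "\<And>g n. smooth g \<Longrightarrow> O_norm \<omega> m (k + n) (?M g) \<le> ereal C * O_norm \<omega> m' n g"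
      using O_norm_mult_left[OF \<omega> f m] by blast
    have fs: "smooth f" using f by (auto simp: OC_step_def O_step_def)
    have map: "?M g \<in> O_step \<omega> m (k + n)" if "g \<in> O_step \<omega> m' n" for g
    proof -
      have g: "smooth g" "O_norm \<omega> m' n g < \<infinity>" using that by (auto simp: O_step_def)
      have "ereal C * O_norm \<omega> m' n g < \<infinity>"
        using g(2) C O_norm_nonneg[of \<omega> m' n g] by (cases "O_norm \<omega> m' n g") auto
      then show ?thesis
        using M[OF g(1), of n] smooth_mult[OF fs g(1)] by (auto simp: O_step_def)
    qed
    have "openin (norm_topology (O_step \<omega> m' n) (O_norm \<omega> m' n)) (?M -` U' \<inter> O_step \<omega> m' n)"
      unfolding openin_norm_topology
    proof (intro conjI ballI)
      fix g assume g: "g \<in> ?M -` U' \<inter> O_step \<omega> m' n"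
      then obtain e where e: "e > 0" "\<And>g'. g' \<in> O_step \<omega> m (k + n) \<Longrightarrow>
          O_norm \<omega> m (k + n) (\<lambda>x. g' x - f x * g x) < ereal e \<Longrightarrow> g' \<in> U'"
        using U' unfolding openin_norm_topology by fastforce
      show "\<exists>\<epsilon>>0. \<forall>g'\<in>O_step \<omega> m' n. O_norm \<omega> m' n (\<lambda>x. g' x - g x) < ereal \<epsilon> \<longrightarrow>
          g' \<in> ?M -` U' \<inter> O_step \<omega> m' n"
      \<comment> \<open>\<open>C\<close> is a Lipschitz constant: \<open>f * g' - f * g\<close>
        equals \<open>f * (g' - g)\<close>, whose norm is at most \<open>C\<close> times that of
        \<open>g' - g\<close>.\<close>
      proof (intro exI[of _ "e / C"] conjI ballI impI)
        show "e / C > 0" using e C by simp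
        fix g' assume g': "g' \<in> O_step \<omega> m' n" "O_norm \<omega> m' n (\<lambda>x. g' x - g x) < ereal (e / C)"
        have "ereal C * O_norm \<omega> m' n (\<lambda>x. g' x - g x) < ereal e"
          using g'(2) C by (cases "O_norm \<omega> m' n (\<lambda>x. g' x - g x)") (auto simp: field_simps)
        moreover have "smooth (\<lambda>x. g' x - g x)"
          using g g'(1) by (intro smooth_diff) (auto simp: O_step_def)
        ultimately have "O_norm \<omega> m (k + n) (\<lambda>x. f x * g' x - f x * g x) < ereal e"
          using M[of "\<lambda>x. g' x - g x" n] by (auto simp: right_diff_distrib)
        then show "g' \<in> ?M -` U' \<inter> O_step \<omega> m' n"
          using e(2)[OF map[OF g'(1)]] g'(1) by simp
      qed
    qed simp
    then have "openin (S n) ((?M -` U' \<inter> O_step \<omega> m' n) \<inter> (\<Inter>m\<in>{1..}. O_step \<omega> m n))"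
      unfolding S using m' by (intro topology_generated_by_Basis) auto
    \<comment> \<open>On the carrier of \<open>S n\<close> the product lies in
      \<open>OC_step \<omega> (k + n)\<close> automatically, so lying in \<open>U\<close> reduces to
      lying in \<open>U'\<close>.\<close>
    also have "(?M -` U' \<inter> O_step \<omega> m' n) \<inter> (\<Inter>m\<in>{1..}. O_step \<omega> m n) = ?M -` U \<inter> topspace (S n)"
      using m' OC_step_mult[OF \<omega> f] unfolding U top by (auto simp: OC_step_def)
    finally show "openin (S n) (?M -` U \<inter> topspace (S n))" .
  next
    have "\<Union> (?G (k + n)) = OC_step \<omega> (k + n)"
      using top[of "k + n"] unfolding S topology_generated_by_topspace .
    then show "?M ` topspace (S n) \<subseteq> \<Union> (?G (k + n))"
      using OC_step_mult[OF \<omega> f] unfolding top by auto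
  qed
qed

lemma continuous_map_OC_mult:
  assumes \<omega>: "nonquasianalytic_weight \<omega>" and f: "f \<in> OC_space \<omega>"
  shows "continuous_map (OC_topology \<omega>) (OC_topology \<omega>) (\<lambda>g x. f x * g x)"
  unfolding OC_topology_def
proof (rule continuous_map_lc_inductive_limit_mult)
  obtain k where k: "k \<ge> 1" "f \<in> OC_step \<omega> k" using f by (auto simp: OC_space_eq)
  show "\<exists>n'\<in>{1..}. continuous_map
      (projective_limit {1..} (\<lambda>m. norm_topology (O_step \<omega> m n) (O_norm \<omega> m n)))
      (projective_limit {1..} (\<lambda>m. norm_topology (O_step \<omega> m n') (O_norm \<omega> m n'))) (\<lambda>g x. f x * g x)"
    for n
    using continuous_map_step_mult[OF \<omega> k(2)] k(1) by (intro bexI[of _ "k + n"]) auto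
  have "(\<Union>n\<in>{1..}. topspace (projective_limit {1..}
      (\<lambda>m. norm_topology (O_step \<omega> m n) (O_norm \<omega> m n)))) = OC_space \<omega>"
    by (subst topspace_projective_limit) (auto simp: OC_space_def)
  then show "(\<lambda>x. f x * g x) \<in> (\<Union>n\<in>{1..}. topspace (projective_limit {1..}
      (\<lambda>m. norm_topology (O_step \<omega> m n) (O_norm \<omega> m n))))"
    if "g \<in> (\<Union>n\<in>{1..}. topspace (projective_limit {1..}
      (\<lambda>m. norm_topology (O_step \<omega> m n) (O_norm \<omega> m n))))" for g
    using OC_space_mult[OF \<omega> f] that by blast
qed

theorem proposition3p6:
  fixes \<omega> :: "real \<Rightarrow> real"
  assumes "nonquasianalytic_weight \<omega>"
  shows "multipliers \<omega> (OC_space \<omega> :: (real ^ 'n::finite \<Rightarrow> complex) set) (OC_topology \<omega>) = OC_space \<omega>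
    \<and> (\<forall>f \<in> (OC_space \<omega> :: (real ^ 'n::finite \<Rightarrow> complex) set). \<forall>g \<in> OC_space \<omega>.
          (\<lambda>x. f x * g x) \<in> OC_space \<omega>)"
proof (intro conjI ballI)
  show "multipliers \<omega> (OC_space \<omega> :: (real ^ 'n \<Rightarrow> complex) set) (OC_topology \<omega>) = OC_space \<omega>"
  proof
    show "multipliers \<omega> (OC_space \<omega> :: (real ^ 'n \<Rightarrow> complex) set) (OC_topology \<omega>) \<subseteq> OC_space \<omega>"
      \<comment> \<open>The multiplier condition is applied to the constant function 1.\<close>
      using const_in_OC_space[OF assms] by (fastforce simp: multipliers_def)
    show "OC_space \<omega> \<subseteq> multipliers \<omega> (OC_space \<omega> :: (real ^ 'n \<Rightarrow> complex) set) (OC_topology \<omega>)"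
      using OC_space_subset_E_space[OF assms] OC_space_mult[OF assms] continuous_map_OC_mult[OF assms]
      by (auto simp: multipliers_def)
  qed
qed (rule OC_space_mult[OF assms])

end
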